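(* Let $$e_m(x)=\delta_m\,{}_2F_1\!\left({-m,\;m-N+\beta\atop -N};x\right),\qquad d^*_n(x)=\gamma^*_n\,x^{-1-n}(1-x)^{\alpha-1},\qquad m,n=0,\dots,N,$$ where $\delta_m,\gamma_n^*$ are normalization constants. Then the overlaps $U_m(n)=(e_m,d^*_n)=\frac1{2\pi i}\oint_\Gamma e_m(x)d^*_n(x)\,dx$ are $$U_m(n)=\delta_m\gamma^*_n\,\frac{(1-\alpha)_n}{n!}\;{}_3F_2\!\left({-n,\,-m,\,m-N+\beta\atop -N,\;\alpha-n};1\right).$$ With $n$ as the variable, this is, up to a normalization factor, the rational function of Hahn type $$\mathcal U_m(n;\alpha,\beta,N)=\frac{(-1)^m(-N)_m}{(\beta+1)_m}\,{}_3F_2\!\left({-n,-m,\beta+m-N\atop -N,\alpha-n};1\right)$$ multiplied by $\delta_m\gamma^*_n\frac{(1-\alpha)_n}{n!}$.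
   Context: $\alpha,\beta$ are real parameters and $N$ is a non-negative integer. $(a)_k=a(a+1)\cdots(a+k-1)$. $\Gamma$ is the circle $|x|=a<1$ in the complex plane, and $(1-x)^{s}=\sum_{k\ge0}\frac{(-s)_k}{k!}x^k$. Terminating hypergeometric series with lower parameter $-N$ are the finite sums ending at the first vanishing numerator Pochhammer symbol. In the differential realization $Z=x-1$, $X=x(1-x)\frac{d}{dx}-\alpha$, $V=x(1-x)\frac{d^2}{dx^2}+[x(N-1-\beta)-N]\frac{d}{dx}$ of the meta-Hahn algebra (generated by $X,Z,V$ with $[Z,X]=Z^2+Z$, $[X,V]=\{V,Z\}+\eta_1X+V-\eta_1Z+\eta_0$, $[V,Z]=2X+\eta_1Z+\eta_3$, where $\eta_0=(N-1-\beta)\alpha+\beta+1$, $\eta_1=N-1-\beta$, $\eta_3=2\alpha-\beta-1$), the $e_m$ are eigenfunctions of $V$ and the $d_n^*$ solve $X^Td^*_n=(\alpha-n)Z^Td^*_n$, with $^T$ the Lagrange adjoint. *)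

theory Defs
  imports "HOL-Complex_Analysis.Complex_Analysis"
begin

text \<open>
  Index of the first vanishing numerator Pochhammer symbol of a terminating series; only
  meaningful when some upper parameter is a non-positive integer.
\<close>
definition hyp_length :: "'a::field_char_0 list \<Rightarrow> nat" where
  "hyp_length as = (LEAST k. \<exists>a\<in>set as. pochhammer a k = 0)"

text \<open>
  The truncation matters: a lower parameter \<open>-N\<close> makes later terms of the form \<open>0 / 0\<close>.
\<close>
definition hyp_F :: "'a::field_char_0 list \<Rightarrow> 'a list \<Rightarrow> 'a \<Rightarrow> 'a" where
  "hyp_F as bs z = (\<Sum>k<hyp_length as. fps_nth (fps_hypergeo as bs 1) k * z ^ k)"

text \<open>No term of the terminating series has a zero denominator.\<close>
definition hyp_defined :: "'a::field_char_0 list \<Rightarrow> 'a list \<Rightarrow> bool" where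
  "hyp_defined as bs \<longleftrightarrow> (\<forall>k<hyp_length as. \<forall>b\<in>set bs. pochhammer b k \<noteq> 0)"

text \<open>The power \<open>(1 - x)\<^sup>s\<close> as its binomial series, for \<open>norm x < 1\<close>.\<close>
definition one_minus_power :: "complex \<Rightarrow> complex \<Rightarrow> complex" where
  "one_minus_power s x = (\<Sum>k. pochhammer (- s) k / fact k * x ^ k)"

definition e_fun :: "real \<Rightarrow> nat \<Rightarrow> (nat \<Rightarrow> complex) \<Rightarrow> nat \<Rightarrow> complex \<Rightarrow> complex" where
  "e_fun \<beta> N \<delta> m x =
     \<delta> m * hyp_F [- of_nat m, of_nat m - of_nat N + of_real \<beta>] [- of_nat N] x"

definition d_star :: "real \<Rightarrow> (nat \<Rightarrow> complex) \<Rightarrow> nat \<Rightarrow> complex \<Rightarrow> complex" where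
  "d_star \<alpha> \<gamma> n x = \<gamma> n * x powi (- 1 - int n) * one_minus_power (of_real \<alpha> - 1) x"

definition overlap :: "real \<Rightarrow> (complex \<Rightarrow> complex) \<Rightarrow> (complex \<Rightarrow> complex) \<Rightarrow> complex" where
  "overlap a f g =
     1 / (2 * of_real pi * \<i>) * contour_integral (circlepath 0 (of_real a)) (\<lambda>x. f x * g x)"

definition hahn_rational :: "nat \<Rightarrow> complex \<Rightarrow> real \<Rightarrow> real \<Rightarrow> nat \<Rightarrow> complex" where
  "hahn_rational m x \<alpha> \<beta> N =
     (- 1) ^ m * pochhammer (- of_nat N) m / pochhammer (of_real \<beta> + 1) m *
     hyp_F [- x, - of_nat m, of_real \<beta> + of_nat m - of_nat N] [- of_nat N, of_real \<alpha> - x] 1"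

end

theory Submission
  imports Defs
begin

text \<open>
  On \<open>\<Gamma>\<close> the integrand is \<open>x\<^bsup>-1-n\<^esup>\<close> times the product of a polynomial and a binomial series that
  converges in the unit disc, so by Cauchy's formula the overlap is the coefficient of \<open>x\<^sup>n\<close> in that
  product. The Cauchy product turns into the \<open>\<^sub>3F\<^sub>2\<close> series term by term through the reversal
  \<open>(1-\<alpha>)\<^bsub>n-k\<^esub> / (n-k)! = (1-\<alpha>)\<^sub>n / n! \<cdot> (-n)\<^sub>k / (\<alpha>-n)\<^sub>k\<close>.
\<close>

text \<open>A Pochhammer symbol that vanishes once vanishes at all larger indices. The parameter
  \<open>- of_nat m\<close> supplies such a zero at \<open>Suc m\<close>, so the
  \<open>LEAST\<close> in \<open>hyp_length\<close> is attained.\<close>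

lemma less_hyp_length_iff:
  fixes as :: "'a::field_char_0 list"
  assumes "- of_nat m \<in> set as"
  shows "k < hyp_length as \<longleftrightarrow> (\<forall>a\<in>set as. pochhammer a k \<noteq> 0)"
proof -
  have ex: "\<exists>a\<in>set as. pochhammer a (Suc m) = 0"
    using assms by (intro bexI[of _ "- of_nat m"]) (simp_all add: pochhammer_of_nat_eq_0_iff)
  have zero: "\<exists>a\<in>set as. pochhammer a (hyp_length as) = 0"
    unfolding hyp_length_def by (rule LeastI[where P = "\<lambda>k. \<exists>a\<in>set as. pochhammer a k = 0", OF ex])
  show ?thesis
  proof
    assume "k < hyp_length as"
    thus "\<forall>a\<in>set as. pochhammer a k \<noteq> 0"
      unfolding hyp_length_def using not_less_Least by blast
  next
    assume "\<forall>a\<in>set as. pochhammer a k \<noteq> 0"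
    thus "k < hyp_length as"
      using zero pochhammer_eq_0_mono by (metis not_le)
  qed
qed

lemma pochhammer_diff_over_fact:
  fixes z :: "'a::field_char_0"
  assumes "k \<le> n" and nz: "pochhammer (z - of_nat n) k \<noteq> 0"
  shows "pochhammer (1 - z) (n - k) / fact (n - k) =
           pochhammer (1 - z) n / fact n * (pochhammer (- of_nat n) k / pochhammer (z - of_nat n) k)"
proof -
  \<comment> \<open>The last \<open>k\<close> factors of \<open>pochhammer w n\<close>, taken
    backwards with their signs changed, form \<open>pochhammer (1 - w - of_nat n) k\<close>. The
    cases \<open>w = 1\<close> and \<open>w = 1 - z\<close> give the denominator and the numerator
    of the claim, and their signs cancel in the quotient.\<close>
  have eq: "pochhammer w n = (- 1) ^ k * pochhammer w (n - k) * pochhammer (1 - w - of_nat n) k"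
    for w :: 'a
  proof -
    have "pochhammer (1 - w - of_nat n) k = (- 1) ^ k * pochhammer (w + of_nat (n - k)) k"
      using pochhammer_minus[of "w + of_nat n - 1" k] \<open>k \<le> n\<close>
      by (simp add: of_nat_diff algebra_simps)
    thus ?thesis
      using pochhammer_product[of "n - k" n w] \<open>k \<le> n\<close> by simp
  qed
  have fact: "(fact n :: 'a) = (- 1) ^ k * fact (n - k) * pochhammer (- of_nat n) k"
    using eq[of 1] by (simp flip: pochhammer_fact)
  have num: "pochhammer (1 - z) n =
      (- 1) ^ k * pochhammer (1 - z) (n - k) * pochhammer (z - of_nat n) k"
    using eq[of "1 - z"] by simp
  have "pochhammer (- of_nat n :: 'a) k \<noteq> 0"
    using \<open>k \<le> n\<close> by (simp add: pochhammer_of_nat_eq_0_iff)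
  thus ?thesis
    unfolding fact num using nz by simp
qed

text \<open>Turns the finite sum in \<open>hyp_F\<close> into an evaluated power series, so that it
  can be multiplied by the binomial series as an \<open>fps\<close>.\<close>

lemma eval_fps_cutoff:
  "eval_fps (fps_cutoff L F) x = (\<Sum>k<L. fps_nth F k * x ^ k)"
proof -
  have "eval_fps (fps_cutoff L F) x = (\<Sum>k<L. fps_nth (fps_cutoff L F) k * x ^ k)"
    unfolding eval_fps_def by (rule suminf_finite) auto
  thus ?thesis by simp
qed

lemma fps_conv_radius_cutoff:
  fixes F :: "'a::{banach,real_normed_div_algebra} fps"
  shows "fps_conv_radius (fps_cutoff L F) = \<infinity>"
proof -
  have "fps_conv_radius (fps_cutoff L F) = conv_radius (\<lambda>_. 0 :: 'a)"
    unfolding fps_conv_radius_def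
    by (rule conv_radius_cong') (use eventually_ge_at_top[of L] in eventually_elim, simp)
  thus ?thesis by simp
qed

lemma one_minus_power_eq_eval_fps: "one_minus_power s = eval_fps (fps_hypergeo [- s] [] 1)"
  by (simp add: fun_eq_iff one_minus_power_def eval_fps_def)

text \<open>The general binomial theorem at \<open>-r\<close> gives convergence for every 0 < r < 1;
  the sign of \<open>(-r) ^ k\<close> turns \<open>s gchoose k\<close> into the coefficient
  \<open>pochhammer (- s) k / fact k\<close>.\<close>

lemma fps_conv_radius_one_minus_power:
  "fps_conv_radius (fps_hypergeo [- s] [] (1 :: complex)) \<ge> 1"
  unfolding fps_conv_radius_def
proof (rule conv_radius_geI_ex')
  fix r :: real
  assume "0 < r" "ereal r < 1"
  hence "summable (\<lambda>k. (s gchoose k) * (- of_real r) ^ k)"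
    using gen_binomial_complex[of "- of_real r" s] by (auto simp: sums_iff)
  moreover have "(s gchoose k) * (- of_real r) ^ k =
      fps_nth (fps_hypergeo [- s] [] 1) k * of_real r ^ k" for k
    unfolding power_minus[of "of_real r" k] by (simp add: gbinomial_pochhammer)
  ultimately show "summable (\<lambda>k. fps_nth (fps_hypergeo [- s] [] 1) k * complex_of_real r ^ k)"
    by simp
qed

text \<open>Cauchy's formula for the \<open>n\<close>-th derivative at 0, which is
  \<open>fact n\<close> times the coefficient. The strict bound on \<open>r\<close> keeps the closed
  disc inside the region of convergence.\<close>

lemma contour_integral_circlepath_eval_fps:
  fixes F :: "complex fps"
  assumes "0 < r" and "ereal r < fps_conv_radius F"
  shows "contour_integral (circlepath 0 r) (\<lambda>x. eval_fps F x / x ^ Suc n) =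
           2 * pi * \<i> * fps_nth F n"
proof -
  have sub: "cball (0 :: complex) r \<subseteq> eball 0 (fps_conv_radius F)"
  proof
    fix x :: complex
    assume "x \<in> cball 0 r"
    hence "ereal (norm x) \<le> ereal r" by simp
    thus "x \<in> eball 0 (fps_conv_radius F)"
      using assms(2) by (simp only: in_eball_iff dist_0_norm order.strict_trans1)
  qed
  have "eval_fps F holomorphic_on ball 0 r"
    using sub by (intro holomorphic_on_eval_fps) (meson ball_subset_cball order_trans)
  moreover have "continuous_on (cball 0 r) (eval_fps F)"
    using sub by (intro holomorphic_on_imp_continuous_on holomorphic_on_eval_fps)
  moreover have "0 < fps_conv_radius F"
    using assms by (metis ereal_less(2) less_trans)
  ultimately show ?thesis
    using Cauchy_contour_integral_circlepath[of 0 r "eval_fps F" 0 n] assms(1)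
    by (simp add: fps_nth_conv_deriv)
qed

lemma overlap_eval_fps:
  fixes F G :: "complex fps"
  assumes "0 < r" and "ereal r < fps_conv_radius F" and "ereal r < fps_conv_radius G"
  shows "overlap r (\<lambda>x. c * eval_fps F x) (\<lambda>x. d * x powi (- 1 - int n) * eval_fps G x) =
           c * d * fps_nth (F * G) n"
proof -
  \<comment> \<open>With the constants absorbed into one series, the integrand on the circle is
    exactly \<open>eval_fps H x / x ^ Suc n\<close>.\<close>
  define H where "H = fps_const (c * d) * (F * G)"
  have FG: "ereal r < fps_conv_radius (F * G)"
    using fps_conv_radius_mult[of F G] assms by (meson less_le_trans min_less_iff_conj)
  have H: "ereal r < fps_conv_radius H"
    using fps_conv_radius_mult[of "fps_const (c * d)" "F * G"] FG
    by (auto simp: H_def)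
  have "contour_integral (circlepath 0 r)
          (\<lambda>x. c * eval_fps F x * (d * x powi (- 1 - int n) * eval_fps G x)) =
        contour_integral (circlepath 0 r) (\<lambda>x. eval_fps H x / x ^ Suc n)"
  proof (rule contour_integral_eq)
    fix x
    assume "x \<in> path_image (circlepath 0 r)"
    hence x: "norm x = r"
      using assms(1) by simp
    have "x powi (- 1 - int n) = inverse (x ^ Suc n)"
      using power_int_minus[of x "int (Suc n)"] unfolding power_int_of_nat by simp
    moreover have "eval_fps H x = c * d * (eval_fps F x * eval_fps G x)"
      using x FG assms by (simp add: H_def eval_fps_mult)
    ultimately show "c * eval_fps F x * (d * x powi (- 1 - int n) * eval_fps G x) =
        eval_fps H x / x ^ Suc n"
      by (simp add: divide_inverse mult_ac)
  qed
  also have "\<dots> = 2 * pi * \<i> * (c * d * fps_nth (F * G) n)"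
    using contour_integral_circlepath_eval_fps[OF assms(1) H] by (simp add: H_def)
  finally show ?thesis
    by (simp add: overlap_def of_real_eq_id)
qed

text \<open>The parameters \<open>u\<close> and \<open>b\<close> pass through unchanged; only the
  convolution with the binomial series adds the new pair \<open>- of_nat n\<close> and \<alpha> -
  n.\<close>

lemma overlap_hyp_F:
  fixes \<alpha> a :: real and n p :: nat and u b c d :: complex
  assumes "0 < a" and "a < 1"
    and "hyp_defined [- of_nat n, - of_nat p, u] [b, complex_of_real \<alpha> - of_nat n]"
  shows "overlap a (\<lambda>x. c * hyp_F [- of_nat p, u] [b] x)
             (\<lambda>x. d * x powi (- 1 - int n) * one_minus_power (of_real \<alpha> - 1) x) =
           c * d * (pochhammer (1 - complex_of_real \<alpha>) n / fact n) *
           hyp_F [- of_nat n, - of_nat p, u] [b, complex_of_real \<alpha> - of_nat n] 1"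
proof -
  define A where "A = complex_of_real \<alpha>"
  define F where "F = fps_hypergeo [- of_nat p, u] [b] 1"
  define G where "G = fps_hypergeo [1 - A] [] 1"
  define L where "L = hyp_length [- of_nat p, u]"
  define M where "M = hyp_length [- of_nat n, - of_nat p, u]"
  define T where "T = fps_hypergeo [- of_nat n, - of_nat p, u] [b, A - of_nat n] 1"
  \<comment> \<open>The extra numerator parameter \<open>- of_nat n\<close> first vanishes at
    \<open>k = n + 1\<close>, so it cuts the series off exactly where the convolution for the
    coefficient of \<open>x ^ n\<close> stops.\<close>
  have M_iff: "k < M \<longleftrightarrow> k \<le> n \<and> k < L" for k
    using less_hyp_length_iff[of p "[- of_nat n, - of_nat p, u]" k]
      less_hyp_length_iff[of p "[- of_nat p, u]" k]
    by (auto simp: M_def L_def pochhammer_of_nat_eq_0_iff)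
  have coeff: "fps_nth F k * fps_nth G (n - k) = pochhammer (1 - A) n / fact n * fps_nth T k"
    if "k < M" for k
  proof -
    \<comment> \<open>\<open>hyp_defined\<close> supplies the nonzero denominator on which the
      reversal depends.\<close>
    have "k \<le> n" "pochhammer (A - of_nat n) k \<noteq> 0"
      using that assms(3) M_iff unfolding hyp_defined_def A_def M_def by auto
    from pochhammer_diff_over_fact[OF this] show ?thesis
      by (simp add: F_def G_def T_def mult_ac)
  qed
  have G: "ereal a < fps_conv_radius G"
    using less_le_trans[OF _ fps_conv_radius_one_minus_power[of "A - 1"], of "ereal a"] \<open>a < 1\<close>
    by (simp add: G_def)
  have "overlap a (\<lambda>x. c * hyp_F [- of_nat p, u] [b] x)
          (\<lambda>x. d * x powi (- 1 - int n) * one_minus_power (A - 1) x) =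
        c * d * fps_nth (fps_cutoff L F * G) n"
    using overlap_eval_fps[OF \<open>0 < a\<close> _ G, of "fps_cutoff L F" c d n]
    by (simp add: fps_conv_radius_cutoff eval_fps_cutoff hyp_F_def one_minus_power_eq_eval_fps
          F_def G_def L_def del: fps_hypergeo_nth)
  \<comment> \<open>The convolution runs over k \<le> n and the cutoff removes every k \<ge> L; by
    \<open>M_iff\<close> the indices below \<open>M\<close> remain.\<close>
  also have "fps_nth (fps_cutoff L F * G) n = (\<Sum>k<M. fps_nth F k * fps_nth G (n - k))"
    unfolding fps_mult_nth by (rule sum.mono_neutral_cong_right) (auto simp: M_iff)
  also have "\<dots> = pochhammer (1 - A) n / fact n * (\<Sum>k<M. fps_nth T k)"
    by (simp add: coeff sum_distrib_left)
  finally show ?thesis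
    by (simp add: hyp_F_def T_def M_def A_def mult.assoc del: fps_hypergeo_nth)
qed

theorem mainTheorem14:
  fixes \<alpha> \<beta> a :: real and N m n :: nat and \<delta> \<gamma> :: "nat \<Rightarrow> complex"
  assumes "0 < a" and "a < 1"
    and "m \<le> N" and "n \<le> N"
    and "hyp_defined
           [- of_nat n, - of_nat m, of_nat m - of_nat N + complex_of_real \<beta>]
           [- of_nat N, complex_of_real \<alpha> - of_nat n]"
  shows "overlap a (e_fun \<beta> N \<delta> m) (d_star \<alpha> \<gamma> n) =
           \<delta> m * \<gamma> n * (pochhammer (1 - complex_of_real \<alpha>) n / fact n) *
           hyp_F [- of_nat n, - of_nat m, of_nat m - of_nat N + complex_of_real \<beta>]
                 [- of_nat N, complex_of_real \<alpha> - of_nat n] 1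
       \<and> (pochhammer (complex_of_real \<beta> + 1) m \<noteq> 0 \<longrightarrow>
           pochhammer (complex_of_real \<beta> + 1) m / ((- 1) ^ m * pochhammer (- of_nat N) m)
             \<noteq> (0 :: complex)
         \<and> overlap a (e_fun \<beta> N \<delta> m) (d_star \<alpha> \<gamma> n) =
             pochhammer (complex_of_real \<beta> + 1) m / ((- 1) ^ m * pochhammer (- of_nat N) m) *
             (\<delta> m * \<gamma> n * (pochhammer (1 - complex_of_real \<alpha>) n / fact n) *
              hahn_rational m (of_nat n) \<alpha> \<beta> N))"
proof -
  have overlap: "overlap a (e_fun \<beta> N \<delta> m) (d_star \<alpha> \<gamma> n) =
      \<delta> m * \<gamma> n * (pochhammer (1 - complex_of_real \<alpha>) n / fact n) *
      hyp_F [- of_nat n, - of_nat m, of_nat m - of_nat N + complex_of_real \<beta>]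
            [- of_nat N, complex_of_real \<alpha> - of_nat n] 1"
    using overlap_hyp_F[OF assms(1,2,5)] by (simp add: e_fun_def[abs_def] d_star_def[abs_def])
  \<comment> \<open>Since m \<le> N, the prefactor of \<open>hahn_rational\<close> can be inverted
    once \<open>pochhammer (complex_of_real \<beta> + 1) m\<close> is nonzero.\<close>
  have "pochhammer (- of_nat N :: complex) m \<noteq> 0"
    using assms(3) by (simp add: pochhammer_of_nat_eq_0_iff)
  moreover have "of_real \<beta> + of_nat m - of_nat N = of_nat m - of_nat N + complex_of_real \<beta>"
    by simp
  ultimately show ?thesis
    unfolding overlap hahn_rational_def by (simp only:) simp
qed

end
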